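(* Let $(\mathcal{M}, g, A)$ be a K\"ahler manifold of dimension $n$ with a quarter-symmetric metric $A$-connection $\overset{1}{\nabla}_XY=\overset{g}{\nabla}_XY-\pi(X)AY$ with generator $\pi$. The tensor $$\begin{aligned}\overset{5}{H}(X,Y)Z={}&\overset{5}{R}(X,Y)Z+\frac{1}{n-1}\big(\overset{5}{R}ic(X,Y)Z-\overset{5}{R}ic(Y,Z)X\big)-\frac{1}{2(n-1)}\big(\overset{1}{R}ic(X,Y)Z-\overset{1}{R}ic(Y,Z)X\big)\\&-\frac{1}{2(n-1)}\big(\overset{3}{'R}(AY,AX)Z-\overset{3}{'R}(AZ,AY)X\big)\\&+\frac12\big(\overset{1}{R}ic(Y,AX)AZ-\overset{3}{R}ic(Z,AY)AX-\overset{3}{'R}(AZ,X)AY\big)\end{aligned}$$ is independent of the generator $\pi$; that is, for any two 1-forms $\pi,\tilde\pi$ on $\mathcal{M}$, the tensors $\overset{5}{H}$ constructed from $\pi$ and from $\tilde\pi$ coincide.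
   Context: A K\"ahler manifold $(\mathcal{M},g,A)$ is a Riemannian manifold $(\mathcal{M},g)$ of dimension $n=2k\ge4$ with a $(1,1)$ tensor field $A$ satisfying $A^2=-I$, $g(AX,AY)=g(X,Y)$ and $\overset{g}{\nabla}A=0$, where $\overset{g}{\nabla}$ is the Levi-Civita connection. $\overset{g}{R}$ is the Riemannian curvature tensor of $g$, $\overset{g}{R}(X,Y)Z=\overset{g}{\nabla}_X\overset{g}{\nabla}_YZ-\overset{g}{\nabla}_Y\overset{g}{\nabla}_XZ-\overset{g}{\nabla}_{[X,Y]}Z$. For a 1-form $\pi$ (the generator) put $$\overset{1}{D}(X,Y)=(\overset{g}{\nabla}_X\pi)(Y)-(\overset{g}{\nabla}_Y\pi)(X),\quad \overset{2}{D}(X,Y)=(\overset{g}{\nabla}_X\pi)(Y)+\pi(Y)\pi(AX),\quad \overset{3}{D}(X,Y)=(\overset{g}{\nabla}_X\pi)(Y)+\pi(X)\pi(AY).$$ The curvature tensors of the first, third and fifth kind are $$\overset{1}{R}(X,Y)Z=\overset{g}{R}(X,Y)Z-\overset{1}{D}(X,Y)AZ,$$ $$\overset{3}{R}(X,Y)Z=\overset{g}{R}(X,Y)Z-\overset{2}{D}(X,Y)AZ+\overset{3}{D}(Y,Z)AX,$$ $$\overset{5}{R}(X,Y)Z=\overset{g}{R}(X,Y)Z-\tfrac12\big(\overset{2}{D}(X,Y)-\overset{3}{D}(Y,X)\big)AZ-\tfrac12\overset{3}{D}(X,Z)AY+\tfrac12\overset{2}{D}(Y,Z)AX-\tfrac12\pi(Y)\big(\pi(X)Z-\pi(Z)X\big).$$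 For $\theta\in\{1,3,5\}$, $\overset{\theta}{R}ic(Y,Z)=\mathrm{Trace}\{X\mapsto\overset{\theta}{R}(X,Y)Z\}$, and $\overset{3}{'R}(X,Y)=\mathrm{Trace}\{Z\mapsto\overset{3}{R}(X,Y)Z\}$. *)

theory Defs
  imports "HOL-Analysis.Analysis"
begin

section \<open>Smooth maps\<close>

primrec Ck_on :: "nat \<Rightarrow> 'v::real_normed_vector set \<Rightarrow> ('v \<Rightarrow> 'w::real_normed_vector) \<Rightarrow> bool" where
  "Ck_on 0 S f \<longleftrightarrow> continuous_on S f"
| "Ck_on (Suc k) S f \<longleftrightarrow>
     (\<forall>x\<in>S. f differentiable (at x)) \<and> (\<forall>v. Ck_on k S (\<lambda>x. frechet_derivative f (at x) v))"

text \<open>Only used for open subsets \<open>S\<close> of a finite-dimensional space.\<close>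

definition smooth_on :: "'v::real_normed_vector set \<Rightarrow> ('v \<Rightarrow> 'w::real_normed_vector) \<Rightarrow> bool" where
  "smooth_on S f \<longleftrightarrow> (\<forall>k. Ck_on k S f)"


section \<open>Smooth manifolds\<close>

text \<open>A chart is a pair of an open subset of the manifold and a coordinate map on it; the
  values of the coordinate map outside that subset are irrelevant. The dimension of the
  manifold is \<open>CARD('n)\<close>.\<close>

type_synonym ('a, 'n) chart = "'a set \<times> ('a \<Rightarrow> real^'n)"

definition coords :: "('a, 'n::finite) chart \<Rightarrow> (real^'n) set" where
  "coords c = snd c ` fst c"

definition overlap :: "('a, 'n::finite) chart \<Rightarrow> ('a, 'n) chart \<Rightarrow> (real^'n) set" where
  "overlap c d = snd c ` (fst c \<inter> fst d)"

definition transition :: "('a, 'n::finite) chart \<Rightarrow> ('a, 'n) chart \<Rightarrow> real^'n \<Rightarrow> real^'n" where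
  "transition c d = snd d \<circ> inv_into (fst c) (snd c)"

definition dtransition ::
    "('a, 'n::finite) chart \<Rightarrow> ('a, 'n) chart \<Rightarrow> real^'n \<Rightarrow> real^'n \<Rightarrow> real^'n" where
  "dtransition c d x = frechet_derivative (transition c d) (at x)"

locale smooth_manifold =
  fixes M :: "'a topology" and atlas :: "('a, 'n::finite) chart set"
  assumes Hausdorff: "Hausdorff_space M"
    and second_countable: "second_countable M"
    and chart_domain: "c \<in> atlas \<Longrightarrow> openin M (fst c)"
    and chart_image: "c \<in> atlas \<Longrightarrow> open (coords c)"
    and chart_homeo: "c \<in> atlas \<Longrightarrow>
      homeomorphic_map (subtopology M (fst c)) (top_of_set (coords c)) (snd c)"
    and cover: "(\<Union>c\<in>atlas. fst c) = topspace M"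
    and smooth_transition: "c \<in> atlas \<Longrightarrow> d \<in> atlas \<Longrightarrow> smooth_on (overlap c d) (transition c d)"


section \<open>Tensor fields\<close>

text \<open>Tensor fields are given by their coordinate representations. A family \<open>T\<close> assigns to a
  chart \<open>c\<close> and a coordinate vector \<open>x \<in> coords c\<close> the representation, in the coordinates of
  \<open>c\<close>, of the tensor at the point of the manifold with coordinates \<open>x\<close>; tangent vectors at
  that point are thereby identified with \<open>real^'n\<close>. Representations in overlapping charts are
  related by the derivative of the transition map.\<close>

definition one_form ::
    "('a, 'n::finite) chart set \<Rightarrow> (('a, 'n) chart \<Rightarrow> real^'n \<Rightarrow> real^'n \<Rightarrow> real) \<Rightarrow> bool" where
  "one_form atlas \<pi> \<longleftrightarrow>
     (\<forall>c\<in>atlas. (\<forall>x\<in>coords c. linear (\<pi> c x)) \<and> (\<forall>v. smooth_on (coords c) (\<lambda>x. \<pi> c x v))) \<and>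
     (\<forall>c\<in>atlas. \<forall>d\<in>atlas. \<forall>x\<in>overlap c d. \<forall>v.
        \<pi> d (transition c d x) (dtransition c d x v) = \<pi> c x v)"

definition endomorphism_field ::
    "('a, 'n::finite) chart set \<Rightarrow> (('a, 'n) chart \<Rightarrow> real^'n \<Rightarrow> real^'n \<Rightarrow> real^'n) \<Rightarrow> bool" where
  "endomorphism_field atlas A \<longleftrightarrow>
     (\<forall>c\<in>atlas. (\<forall>x\<in>coords c. linear (A c x)) \<and> (\<forall>v. smooth_on (coords c) (\<lambda>x. A c x v))) \<and>
     (\<forall>c\<in>atlas. \<forall>d\<in>atlas. \<forall>x\<in>overlap c d. \<forall>v.
        A d (transition c d x) (dtransition c d x v) = dtransition c d x (A c x v))"

definition riemannian_metric ::
    "('a, 'n::finite) chart set \<Rightarrow> (('a, 'n) chart \<Rightarrow> real^'n \<Rightarrow> real^'n \<Rightarrow> real^'n \<Rightarrow> real) \<Rightarrow> bool" where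
  "riemannian_metric atlas g \<longleftrightarrow>
     (\<forall>c\<in>atlas.
        (\<forall>x\<in>coords c. bilinear (g c x) \<and> (\<forall>u v. g c x u v = g c x v u) \<and>
           (\<forall>v. v \<noteq> 0 \<longrightarrow> g c x v v > 0)) \<and>
        (\<forall>u v. smooth_on (coords c) (\<lambda>x. g c x u v))) \<and>
     (\<forall>c\<in>atlas. \<forall>d\<in>atlas. \<forall>x\<in>overlap c d. \<forall>u v.
        g d (transition c d x) (dtransition c d x u) (dtransition c d x v) = g c x u v)"


section \<open>Vector fields and connections in a chart\<close>

text \<open>A vector field on the domain of a chart is represented by its components. Operators
  below take the components of vector fields, of the endomorphism field \<open>A\<close> and of the 1-form
  \<open>\<pi>\<close> in one chart, together with the coefficients \<open>\<Gamma> x u v\<close> of the connection in that chart.\<close>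

type_synonym 'n vfield = "real^'n \<Rightarrow> real^'n"

definition deriv_along :: "'n::finite vfield \<Rightarrow> (real^'n \<Rightarrow> 'w::real_normed_vector) \<Rightarrow> real^'n \<Rightarrow> 'w" where
  "deriv_along X f x = frechet_derivative f (at x) (X x)"

definition lie_bracket :: "'n::finite vfield \<Rightarrow> 'n vfield \<Rightarrow> 'n vfield" where
  "lie_bracket X Y x = deriv_along X Y x - deriv_along Y X x"

definition app :: "(real^'n::finite \<Rightarrow> real^'n \<Rightarrow> 'w) \<Rightarrow> 'n vfield \<Rightarrow> real^'n \<Rightarrow> 'w" where
  "app T X x = T x (X x)"

definition nabla :: "(real^'n::finite \<Rightarrow> real^'n \<Rightarrow> real^'n \<Rightarrow> real^'n) \<Rightarrow> 'n vfield \<Rightarrow> 'n vfield \<Rightarrow> 'n vfield" where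
  "nabla \<Gamma> X Y x = deriv_along X Y x + \<Gamma> x (X x) (Y x)"

definition nabla_form :: "(real^'n::finite \<Rightarrow> real^'n \<Rightarrow> real^'n \<Rightarrow> real^'n) \<Rightarrow>
    (real^'n \<Rightarrow> real^'n \<Rightarrow> real) \<Rightarrow> 'n vfield \<Rightarrow> 'n vfield \<Rightarrow> real^'n \<Rightarrow> real" where
  "nabla_form \<Gamma> \<pi> X Y x = deriv_along X (app \<pi> Y) x - app \<pi> (nabla \<Gamma> X Y) x"

definition nabla_endo :: "(real^'n::finite \<Rightarrow> real^'n \<Rightarrow> real^'n \<Rightarrow> real^'n) \<Rightarrow>
    (real^'n \<Rightarrow> real^'n \<Rightarrow> real^'n) \<Rightarrow> 'n vfield \<Rightarrow> 'n vfield \<Rightarrow> 'n vfield" where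
  "nabla_endo \<Gamma> A X Y x = nabla \<Gamma> X (app A Y) x - app A (nabla \<Gamma> X Y) x"

definition nabla_metric :: "(real^'n::finite \<Rightarrow> real^'n \<Rightarrow> real^'n \<Rightarrow> real^'n) \<Rightarrow>
    (real^'n \<Rightarrow> real^'n \<Rightarrow> real^'n \<Rightarrow> real) \<Rightarrow> 'n vfield \<Rightarrow> 'n vfield \<Rightarrow> 'n vfield \<Rightarrow> real^'n \<Rightarrow> real" where
  "nabla_metric \<Gamma> g X Y Z x = deriv_along X (\<lambda>y. g y (Y y) (Z y)) x
     - g x (nabla \<Gamma> X Y x) (Z x) - g x (Y x) (nabla \<Gamma> X Z x)"

text \<open>The last clause is the transformation law of connection coefficients, saying that
  \<open>nabla\<close> maps vector fields to vector fields independently of the chart.\<close>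

definition affine_connection :: "('a, 'n::finite) chart set \<Rightarrow>
    (('a, 'n) chart \<Rightarrow> real^'n \<Rightarrow> real^'n \<Rightarrow> real^'n \<Rightarrow> real^'n) \<Rightarrow> bool" where
  "affine_connection atlas \<Gamma> \<longleftrightarrow>
     (\<forall>c\<in>atlas. (\<forall>x\<in>coords c. bilinear (\<Gamma> c x)) \<and>
        (\<forall>u v. smooth_on (coords c) (\<lambda>x. \<Gamma> c x u v))) \<and>
     (\<forall>c\<in>atlas. \<forall>d\<in>atlas. \<forall>x\<in>overlap c d. \<forall>u v.
        frechet_derivative (\<lambda>y. dtransition c d y v) (at x) u
          + \<Gamma> d (transition c d x) (dtransition c d x u) (dtransition c d x v)
        = dtransition c d x (\<Gamma> c x u v))"

definition levi_civita :: "('a, 'n::finite) chart set \<Rightarrow>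
    (('a, 'n) chart \<Rightarrow> real^'n \<Rightarrow> real^'n \<Rightarrow> real^'n \<Rightarrow> real) \<Rightarrow>
    (('a, 'n) chart \<Rightarrow> real^'n \<Rightarrow> real^'n \<Rightarrow> real^'n \<Rightarrow> real^'n) \<Rightarrow> bool" where
  "levi_civita atlas g \<Gamma> \<longleftrightarrow> affine_connection atlas \<Gamma> \<and>
     (\<forall>c\<in>atlas. \<forall>X Y. smooth_on (coords c) X \<and> smooth_on (coords c) Y \<longrightarrow>
        (\<forall>x\<in>coords c. nabla (\<Gamma> c) X Y x - nabla (\<Gamma> c) Y X x = lie_bracket X Y x)) \<and>
     (\<forall>c\<in>atlas. \<forall>X Y Z. smooth_on (coords c) X \<and> smooth_on (coords c) Y \<and> smooth_on (coords c) Z \<longrightarrow>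
        (\<forall>x\<in>coords c. nabla_metric (\<Gamma> c) (g c) X Y Z x = 0))"


section \<open>Kaehler manifolds\<close>

locale kaehler_manifold = smooth_manifold M atlas
  for M :: "'a topology" and atlas :: "('a, 'n::finite) chart set" +
  fixes g :: "('a, 'n) chart \<Rightarrow> real^'n \<Rightarrow> real^'n \<Rightarrow> real^'n \<Rightarrow> real"
    and A :: "('a, 'n) chart \<Rightarrow> real^'n \<Rightarrow> real^'n \<Rightarrow> real^'n"
    and \<Gamma> :: "('a, 'n) chart \<Rightarrow> real^'n \<Rightarrow> real^'n \<Rightarrow> real^'n \<Rightarrow> real^'n"
  assumes dimension: "even CARD('n)" "CARD('n) \<ge> 4"
    and metric: "riemannian_metric atlas g"
    and levi_civita: "levi_civita atlas g \<Gamma>"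
    and endomorphism: "endomorphism_field atlas A"
    and square: "c \<in> atlas \<Longrightarrow> x \<in> coords c \<Longrightarrow> A c x (A c x v) = - v"
    and hermitian: "c \<in> atlas \<Longrightarrow> x \<in> coords c \<Longrightarrow> g c x (A c x u) (A c x v) = g c x u v"
    and parallel: "c \<in> atlas \<Longrightarrow> smooth_on (coords c) X \<Longrightarrow> smooth_on (coords c) Y \<Longrightarrow>
      x \<in> coords c \<Longrightarrow> nabla_endo (\<Gamma> c) (A c) X Y x = 0"

text \<open>\<open>N c X Y\<close> is the derivative of \<open>Y\<close> along \<open>X\<close> with respect to the quarter-symmetric metric
  \<open>A\<close>-connection with generator \<open>\<pi>\<close>, for vector fields on the domain of \<open>c\<close>.\<close>

definition quarter_symmetric_connection :: "('a, 'n::finite) chart set \<Rightarrow>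
    (('a, 'n) chart \<Rightarrow> real^'n \<Rightarrow> real^'n \<Rightarrow> real^'n) \<Rightarrow>
    (('a, 'n) chart \<Rightarrow> real^'n \<Rightarrow> real^'n \<Rightarrow> real^'n \<Rightarrow> real^'n) \<Rightarrow>
    (('a, 'n) chart \<Rightarrow> real^'n \<Rightarrow> real^'n \<Rightarrow> real) \<Rightarrow>
    (('a, 'n) chart \<Rightarrow> 'n vfield \<Rightarrow> 'n vfield \<Rightarrow> 'n vfield) \<Rightarrow> bool" where
  "quarter_symmetric_connection atlas A \<Gamma> \<pi> N \<longleftrightarrow>
     (\<forall>c\<in>atlas. \<forall>X Y. smooth_on (coords c) X \<and> smooth_on (coords c) Y \<longrightarrow>
        (\<forall>x\<in>coords c. N c X Y x = nabla (\<Gamma> c) X Y x - app (\<pi> c) X x *\<^sub>R app (A c) Y x))"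


section \<open>Curvature tensors\<close>

definition curvature :: "(real^'n::finite \<Rightarrow> real^'n \<Rightarrow> real^'n \<Rightarrow> real^'n) \<Rightarrow>
    'n vfield \<Rightarrow> 'n vfield \<Rightarrow> 'n vfield \<Rightarrow> 'n vfield" where
  "curvature \<Gamma> X Y Z x = nabla \<Gamma> X (nabla \<Gamma> Y Z) x - nabla \<Gamma> Y (nabla \<Gamma> X Z) x
     - nabla \<Gamma> (lie_bracket X Y) Z x"

text \<open>Traces are taken over the tangent space at \<open>x\<close>; a tangent vector \<open>u\<close> enters a
  tensor through the vector field that is constantly \<open>u\<close> in the coordinates, which is one of
  its extensions to a vector field.\<close>

definition tangent_trace :: "('n::finite vfield \<Rightarrow> 'n vfield) \<Rightarrow> real^'n \<Rightarrow> real" where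
  "tangent_trace T x = trace (matrix (\<lambda>u. T (\<lambda>_. u) x))"

context
  fixes \<Gamma> :: "real^'n::finite \<Rightarrow> real^'n \<Rightarrow> real^'n \<Rightarrow> real^'n"
    and A :: "real^'n \<Rightarrow> real^'n \<Rightarrow> real^'n"
    and \<pi> :: "real^'n \<Rightarrow> real^'n \<Rightarrow> real"
begin

definition D1 :: "'n vfield \<Rightarrow> 'n vfield \<Rightarrow> real^'n \<Rightarrow> real" where
  "D1 X Y x = nabla_form \<Gamma> \<pi> X Y x - nabla_form \<Gamma> \<pi> Y X x"

definition D2 :: "'n vfield \<Rightarrow> 'n vfield \<Rightarrow> real^'n \<Rightarrow> real" where
  "D2 X Y x = nabla_form \<Gamma> \<pi> X Y x + app \<pi> Y x * app \<pi> (app A X) x"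

definition D3 :: "'n vfield \<Rightarrow> 'n vfield \<Rightarrow> real^'n \<Rightarrow> real" where
  "D3 X Y x = nabla_form \<Gamma> \<pi> X Y x + app \<pi> X x * app \<pi> (app A Y) x"

definition R1 :: "'n vfield \<Rightarrow> 'n vfield \<Rightarrow> 'n vfield \<Rightarrow> 'n vfield" where
  "R1 X Y Z x = curvature \<Gamma> X Y Z x - D1 X Y x *\<^sub>R app A Z x"

definition R3 :: "'n vfield \<Rightarrow> 'n vfield \<Rightarrow> 'n vfield \<Rightarrow> 'n vfield" where
  "R3 X Y Z x = curvature \<Gamma> X Y Z x - D2 X Y x *\<^sub>R app A Z x + D3 Y Z x *\<^sub>R app A X x"

definition R5 :: "'n vfield \<Rightarrow> 'n vfield \<Rightarrow> 'n vfield \<Rightarrow> 'n vfield" where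
  "R5 X Y Z x = curvature \<Gamma> X Y Z x
     - ((1/2) * (D2 X Y x - D3 Y X x)) *\<^sub>R app A Z x
     - ((1/2) * D3 X Z x) *\<^sub>R app A Y x
     + ((1/2) * D2 Y Z x) *\<^sub>R app A X x
     - ((1/2) * app \<pi> Y x) *\<^sub>R (app \<pi> X x *\<^sub>R Z x - app \<pi> Z x *\<^sub>R X x)"

definition Ric1 :: "'n vfield \<Rightarrow> 'n vfield \<Rightarrow> real^'n \<Rightarrow> real" where
  "Ric1 Y Z = tangent_trace (\<lambda>X. R1 X Y Z)"

definition Ric3 :: "'n vfield \<Rightarrow> 'n vfield \<Rightarrow> real^'n \<Rightarrow> real" where
  "Ric3 Y Z = tangent_trace (\<lambda>X. R3 X Y Z)"

definition Ric5 :: "'n vfield \<Rightarrow> 'n vfield \<Rightarrow> real^'n \<Rightarrow> real" where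
  "Ric5 Y Z = tangent_trace (\<lambda>X. R5 X Y Z)"

definition trR3 :: "'n vfield \<Rightarrow> 'n vfield \<Rightarrow> real^'n \<Rightarrow> real" where
  "trR3 X Y = tangent_trace (\<lambda>Z. R3 X Y Z)"

definition H5 :: "'n vfield \<Rightarrow> 'n vfield \<Rightarrow> 'n vfield \<Rightarrow> 'n vfield" where
  "H5 X Y Z x = R5 X Y Z x
     + (1 / (real CARD('n) - 1)) *\<^sub>R (Ric5 X Y x *\<^sub>R Z x - Ric5 Y Z x *\<^sub>R X x)
     - (1 / (2 * (real CARD('n) - 1))) *\<^sub>R (Ric1 X Y x *\<^sub>R Z x - Ric1 Y Z x *\<^sub>R X x)
     - (1 / (2 * (real CARD('n) - 1))) *\<^sub>R
         (trR3 (app A Y) (app A X) x *\<^sub>R Z x - trR3 (app A Z) (app A Y) x *\<^sub>R X x)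
     + (1/2) *\<^sub>R (Ric1 Y (app A X) x *\<^sub>R app A Z x
               - Ric3 Z (app A Y) x *\<^sub>R app A X x
               - trR3 (app A Z) X x *\<^sub>R app A Y x)"

end

end

theory Submission
  imports Defs
begin

text \<open>At a point, \<open>P(X, Y) = (\<nabla>\<^sub>X \<pi>)(Y)\<close> is a bilinear form in the values of \<open>X\<close>
  and \<open>Y\<close>, and \<open>trace A = 0\<close> because \<open>A\<close> is skew for \<open>g\<close>. Up to the corresponding traces of the
  Riemannian curvature, the traces of the curvature tensors are therefore
  \<open>Ric1(Y, Z) = P(Y, AZ) - P(AZ, Y)\<close>, \<open>Ric3(Y, Z) = \<pi>(Y) \<pi>(Z) - P(AZ, Y)\<close>,
  \<open>trR3(X, Y) = P(Y, AX) - \<pi>(X) \<pi>(Y)\<close> and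
  \<open>Ric5(Y, Z) = (P(Y, AZ) - P(AZ, Y) - P(AY, Z) - \<pi>(AY) \<pi>(AZ) + (n - 1) \<pi>(Y) \<pi>(Z)) / 2\<close>.
  Substituting them into the definition of \<open>H5\<close>, the coefficients of each of \<open>X\<close>, \<open>Z\<close>, \<open>AX\<close>,
  \<open>AY\<close>, \<open>AZ\<close> that involve \<open>\<pi>\<close> cancel, leaving an expression in the curvature of \<open>g\<close> alone.\<close>

section \<open>Traces over a tangent space\<close>

lemma trace_matrix_eq_sum: "trace (matrix f) = (\<Sum>i\<in>UNIV. f (axis i 1) $ i)"
  by (simp add: trace_def matrix_def)

lemma tangent_trace_add:
  "tangent_trace (\<lambda>X x. S X x + T X x) x = tangent_trace S x + tangent_trace T x"
  by (simp add: tangent_trace_def trace_matrix_eq_sum sum.distrib)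

lemma tangent_trace_diff:
  "tangent_trace (\<lambda>X x. S X x - T X x) x = tangent_trace S x - tangent_trace T x"
  by (simp add: tangent_trace_def trace_matrix_eq_sum sum_subtractf)

lemma tangent_trace_scaleR:
  "tangent_trace (\<lambda>X x. r x *\<^sub>R T X x) x = r x * tangent_trace T x"
  by (simp add: tangent_trace_def trace_matrix_eq_sum sum_distrib_left)

lemma tangent_trace_id: "tangent_trace (\<lambda>X x. X x) x = real CARD('n)"
  for x :: "real^'n::finite"
  by (simp add: tangent_trace_def trace_matrix_eq_sum)

lemma linear_eq_sum_axis: "f v = (\<Sum>i\<in>UNIV. v $ i *\<^sub>R f (axis i 1))"
  if "linear f" for f :: "real^'n::finite \<Rightarrow> 'w::real_vector"
proof -
  have "f v = f (\<Sum>i\<in>UNIV. v $ i *\<^sub>R axis i 1)"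
    using basis_expansion[of v] by (simp add: scalar_mult_eq_scaleR)
  also have "\<dots> = (\<Sum>i\<in>UNIV. v $ i *\<^sub>R f (axis i 1))"
    by (simp add: linear_sum[OF that] linear_scale[OF that])
  finally show ?thesis .
qed

text \<open>Expanding \<open>w x\<close> in the standard basis identifies the trace of
  \<open>u\<close> \<mapsto> \<open>f(u) w\<close> with \<open>f(w)\<close>. This evaluates every
  curvature term in which the traced vector occurs only in the scalar coefficient.\<close>

lemma tangent_trace_rank_one:
  assumes "linear (\<lambda>u. f (\<lambda>_. u) x)"
  shows "tangent_trace (\<lambda>X x. f X x *\<^sub>R w x) x = f (\<lambda>_. w x) x"
  unfolding tangent_trace_def trace_matrix_eq_sum
  by (subst linear_eq_sum_axis[OF assms]) (simp add: mult.commute)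

text \<open>\<open>J\<close> is skew for \<open>b\<close>, so with the Gram matrix \<open>G\<close>
  of \<open>b\<close> the matrix of \<open>J\<close> equals minus the conjugate of its transpose by
  \<open>G\<close>. Trace is invariant under conjugation and transposition, hence equals its own
  negative.\<close>

lemma trace_hermitian_complex_structure:
  fixes J :: "real^'n \<Rightarrow> real^'n::finite"
  assumes J: "linear J" and sq: "\<And>v. J (J v) = - v"
    and b: "bilinear b" and pos: "\<And>v. v \<noteq> 0 \<Longrightarrow> b v v > (0::real)"
    and herm: "\<And>u v. b (J u) (J v) = b u v"
  shows "trace (matrix J) = 0"
proof -
  define G :: "real^'n^'n" where "G = (\<chi> i j. b (axis i 1) (axis j 1))"
  let ?A = "matrix J"
  have lin: "linear (b u)" "linear (\<lambda>u. b u v)" for u v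
    using b by (auto simp: bilinear_def)
  have bG: "b u v = u \<bullet> (G *v v)" for u v
  proof -
    have "b u v = (\<Sum>i\<in>UNIV. u $ i * (\<Sum>j\<in>UNIV. v $ j * b (axis i 1) (axis j 1)))"
      by (subst linear_eq_sum_axis[OF lin(2)], subst linear_eq_sum_axis[OF lin(1)]) simp
    then show ?thesis
      by (simp add: inner_vec_def matrix_vector_mult_def G_def mult.commute)
  qed
  have skew: "b u (J v) = - b (J u) v" for u v
  proof -
    have "b u (J v) = b (J u) (J (J v))" by (simp add: herm)
    then show ?thesis by (simp add: sq bilinear_rneg[OF b])
  qed
  have AJ: "?A *v v = J v" for v
    by (simp add: matrix_works J)
  have GA: "G ** ?A = - (transpose ?A ** G)"
  proof (rule matrix_eq[THEN iffD2], rule allI, rule vector_eq_ldot[THEN iffD1], rule allI)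
    fix u v
    have "u \<bullet> (G ** ?A *v v) = b u (J v)"
      by (simp add: bG AJ flip: matrix_vector_mul_assoc)
    also have "\<dots> = - ((?A *v u) \<bullet> (G *v v))" by (simp add: skew AJ flip: bG)
    also have "(?A *v u) \<bullet> (G *v v) = u \<bullet> ((transpose ?A ** G) *v v)"
      by (metis dot_lmul_matrix vector_transpose_matrix matrix_vector_mul_assoc)
    also have "- \<dots> = u \<bullet> ((- (transpose ?A ** G)) *v v)"
      by (simp add: inner_vec_def matrix_vector_mult_def sum_negf)
    finally show "u \<bullet> (G ** ?A *v v) = u \<bullet> ((- (transpose ?A ** G)) *v v)" .
  qed
  \<comment> \<open>Positive definiteness of \<open>b\<close> makes the Gram matrix
    invertible.\<close>
  have "inj ((*v) G)"
  proof (rule linear_injective_0[THEN iffD2, OF matrix_vector_mul_linear], intro allI impI)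
    fix v assume "G *v v = 0"
    then show "v = 0" using pos[of v] by (force simp: bG)
  qed
  then obtain B where B: "B ** G = mat 1"
    by (auto simp flip: matrix_left_invertible_injective)
  then have B': "G ** B = mat 1" by (simp add: matrix_left_right_inverse)
  have "trace ?A = trace ((B ** G) ** ?A)" by (simp add: B)
  also have "\<dots> = trace (B ** (- (transpose ?A ** G)))"
    by (simp add: matrix_mul_assoc[symmetric] GA)
  also have "\<dots> = trace ((- (transpose ?A ** G)) ** B)" by (rule trace_mul_sym)
  also have "\<dots> = - trace (transpose ?A ** (G ** B))"
    unfolding matrix_mul_assoc by (simp add: trace_def matrix_matrix_mult_def sum_negf)
  also have "\<dots> = - trace ?A" by (simp add: B' trace_def transpose_def)
  finally show ?thesis by simp
qed

section \<open>Differentiation of fields in coordinates\<close>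

text \<open>A product rule when \<open>T\<close> is known to be differentiable only on each fixed
  vector: expanding \<open>Y y\<close> in the standard basis turns \<open>T y (Y y)\<close> into a
  finite sum of scalar functions times the differentiable maps
  \<open>T y (axis i 1)\<close>.\<close>

lemma has_derivative_app:
  fixes T :: "real^'n::finite \<Rightarrow> real^'n \<Rightarrow> 'w::real_normed_vector" and Y :: "'n vfield"
  assumes S: "open S" "x \<in> S" and lin: "\<And>y. y \<in> S \<Longrightarrow> linear (T y)"
    and dT: "\<And>v. (\<lambda>y. T y v) differentiable (at x)" and dY: "Y differentiable (at x)"
  shows "(app T Y has_derivative (\<lambda>h.
      (\<Sum>i\<in>UNIV. Y x $ i *\<^sub>R frechet_derivative (\<lambda>y. T y (axis i 1)) (at x) h)
      + T x (frechet_derivative Y (at x) h))) (at x)"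
proof -
  note [derivative_intros] =
    dY[unfolded frechet_derivative_works] dT[unfolded frechet_derivative_works]
  have Y: "((\<lambda>y. Y y $ i) has_derivative (\<lambda>h. frechet_derivative Y (at x) h $ i)) (at x)" for i
    by (rule bounded_linear.has_derivative[OF bounded_linear_vec_nth])
      (rule derivative_intros)
  have "((\<lambda>y. \<Sum>i\<in>UNIV. Y y $ i *\<^sub>R T y (axis i 1)) has_derivative
      (\<lambda>h. (\<Sum>i\<in>UNIV. Y x $ i *\<^sub>R frechet_derivative (\<lambda>y. T y (axis i 1)) (at x) h
           + frechet_derivative Y (at x) h $ i *\<^sub>R T x (axis i 1)))) (at x)"
    by (intro has_derivative_sum has_derivative_scaleR Y derivative_intros)
  then have "((\<lambda>y. \<Sum>i\<in>UNIV. Y y $ i *\<^sub>R T y (axis i 1)) has_derivative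
      (\<lambda>h. (\<Sum>i\<in>UNIV. Y x $ i *\<^sub>R frechet_derivative (\<lambda>y. T y (axis i 1)) (at x) h)
           + T x (frechet_derivative Y (at x) h))) (at x)"
    by (simp add: sum.distrib linear_eq_sum_axis[OF lin[OF S(2)], of "frechet_derivative _ _ _"])
  then show ?thesis
    \<comment> \<open>The basis expansion agrees with \<open>app T Y\<close> on \<open>S\<close>,
      where \<open>T y\<close> is linear; as \<open>S\<close> is open, the derivative at
      \<open>x\<close> carries over.\<close>
    by (rule has_derivative_transform_within_open[OF _ S])
      (simp add: app_def flip: linear_eq_sum_axis[OF lin])
qed

lemma smooth_on_imp_differentiable:
  assumes "smooth_on S f" "x \<in> S"
  shows "f differentiable (at x)"
proof -
  have "Ck_on (Suc 0) S f" using assms(1) by (simp only: smooth_on_def)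
  then show ?thesis using assms(2) by simp
qed

section \<open>Covariant derivative of the generator and traces of curvature at one point\<close>

text \<open>The data of one chart near one point. Linearity is assumed on all of \<open>S\<close> so
  that \<open>app A Y\<close> and \<open>app \<pi> Y\<close> can be differentiated at
  \<open>x\<close>. The metric is represented by its consequence \<open>trace_A\<close>.\<close>

locale pointwise_complex_structure =
  fixes S :: "(real^'n::finite) set" and x :: "real^'n"
    and \<Gamma> :: "real^'n \<Rightarrow> real^'n \<Rightarrow> real^'n \<Rightarrow> real^'n"
    and A :: "real^'n \<Rightarrow> real^'n \<Rightarrow> real^'n"
    and \<pi> :: "real^'n \<Rightarrow> real^'n \<Rightarrow> real"
  assumes S: "open S" "x \<in> S"
    and bilinear_coeffs: "bilinear (\<Gamma> x)"
    and linear_A: "y \<in> S \<Longrightarrow> linear (A y)"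
    and differentiable_A: "(\<lambda>y. A y v) differentiable (at x)"
    and linear_form: "y \<in> S \<Longrightarrow> linear (\<pi> y)"
    and differentiable_form: "(\<lambda>y. \<pi> y v) differentiable (at x)"
    and square: "A x (A x v) = - v"
    and trace_A: "trace (matrix (A x)) = 0"
    and dim: "CARD('n) > 1"
begin

text \<open>The coordinate expression of the covariant derivative of \<pi> at \<open>x\<close>: the
  components of \<pi> are differentiated along \<open>u\<close> and contracted with
  \<open>v\<close>, then corrected by the connection coefficients.\<close>

definition P :: "real^'n \<Rightarrow> real^'n \<Rightarrow> real" where
  "P u v = (\<Sum>i\<in>UNIV. v $ i *\<^sub>R frechet_derivative (\<lambda>y. \<pi> y (axis i 1)) (at x) u) - \<pi> x (\<Gamma> x u v)"

lemma bilinear_P: "bilinear P"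
proof -
  have d: "linear (frechet_derivative (\<lambda>y. \<pi> y v) (at x))" for v
    by (rule linear_frechet_derivative[OF differentiable_form])
  have \<pi>: "linear (\<pi> x)" by (rule linear_form[OF S(2)])
  show ?thesis
    unfolding bilinear_def linear_iff P_def
    by (simp add: linear_add[OF d] linear_scale[OF d] linear_add[OF \<pi>] linear_scale[OF \<pi>]
        bilinear_ladd[OF bilinear_coeffs] bilinear_radd[OF bilinear_coeffs]
        bilinear_lmul[OF bilinear_coeffs] bilinear_rmul[OF bilinear_coeffs]
        sum.distrib sum_distrib_left algebra_simps)
qed

lemma linear_P: "linear (P u)" "linear (\<lambda>u. P u v)"
  using bilinear_P by (auto simp: bilinear_def)

lemma P_neg: "P (- u) v = - P u v" "P u (- v) = - P u v"
  by (simp_all add: bilinear_lneg[OF bilinear_P] bilinear_rneg[OF bilinear_P])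

lemma form_neg: "\<pi> x (- v) = - \<pi> x v"
  by (rule linear_neg[OF linear_form[OF S(2)]])

lemma app_at: "app T X x = T x (X x)"
  by (simp add: app_def)

lemma differentiable_app_A: "Y differentiable (at x) \<Longrightarrow> app A Y differentiable (at x)"
  using has_derivative_app[OF S linear_A differentiable_A]
  unfolding differentiable_def by blast

text \<open>Tensoriality: the derivative of \<open>Y\<close> produced by the product rule cancels
  the one inside \<open>nabla\<close>, so only the values of \<open>X\<close> and \<open>Y\<close>
  at \<open>x\<close> remain.\<close>

lemma nabla_form_eq: "nabla_form \<Gamma> \<pi> X Y x = P (X x) (Y x)" if "Y differentiable (at x)"
proof -
  have "frechet_derivative (app \<pi> Y) (at x) =
      (\<lambda>h. (\<Sum>i\<in>UNIV. Y x $ i *\<^sub>R frechet_derivative (\<lambda>y. \<pi> y (axis i 1)) (at x) h)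
        + \<pi> x (frechet_derivative Y (at x) h))"
    by (rule frechet_derivative_at[symmetric])
      (rule has_derivative_app[OF S linear_form differentiable_form that])
  then show ?thesis
    by (simp add: nabla_form_def nabla_def deriv_along_def P_def app_at
        linear_add[OF linear_form[OF S(2)]])
qed

lemma tangent_trace_A: "tangent_trace (\<lambda>X. app A X) x = 0"
  using trace_A by (simp add: tangent_trace_def app_at)

lemma D_eq:
  assumes "Y differentiable (at x)"
  shows "D2 \<Gamma> A \<pi> X Y x = P (X x) (Y x) + \<pi> x (Y x) * \<pi> x (A x (X x))"
    and "D3 \<Gamma> A \<pi> X Y x = P (X x) (Y x) + \<pi> x (X x) * \<pi> x (A x (Y x))"
    and "X differentiable (at x) \<Longrightarrow> D1 \<Gamma> \<pi> X Y x = P (X x) (Y x) - P (Y x) (X x)"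
  using assms by (simp_all add: D1_def D2_def D3_def nabla_form_eq app_at)

lemma linear_form_A: "linear (\<lambda>u. \<pi> x (A x u))"
  using linear_compose[OF linear_A[OF S(2)] linear_form[OF S(2)]] by (simp add: o_def)

lemmas linear_rules = linear_P linear_form_A linear_form[OF S(2)]

lemma Ric1_eq:
  assumes "Y differentiable (at x)"
  shows "Ric1 \<Gamma> A \<pi> Y Z x =
    tangent_trace (\<lambda>X. curvature \<Gamma> X Y Z) x - P (A x (Z x)) (Y x) + P (Y x) (A x (Z x))"
proof -
  have "linear (\<lambda>u. D1 \<Gamma> \<pi> (\<lambda>_. u) Y x)"
    using assms by (simp add: D_eq linear_compose_sub linear_rules)
  then show ?thesis
    using assms by (simp add: Ric1_def R1_def[abs_def] tangent_trace_diff tangent_trace_rank_one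
        D_eq app_at)
qed

text \<open>The \<open>D2\<close> term is of rank one and evaluates \<open>D2\<close> at
  \<open>AZ\<close>, where \<open>square\<close> turns the quadratic part into
  \<open>- \<pi>(Y) \<pi>(Z)\<close>; the \<open>D3\<close> term is a multiple of \<open>A\<close>,
  hence traceless.\<close>

lemma Ric3_eq:
  assumes "Y differentiable (at x)" "Z differentiable (at x)"
  shows "Ric3 \<Gamma> A \<pi> Y Z x =
    tangent_trace (\<lambda>X. curvature \<Gamma> X Y Z) x - P (A x (Z x)) (Y x) + \<pi> x (Y x) * \<pi> x (Z x)"
proof -
  have "linear (\<lambda>u. D2 \<Gamma> A \<pi> (\<lambda>_. u) Y x)"
    using assms linear_rules unfolding linear_iff by (simp add: D_eq algebra_simps)
  then show ?thesis
    using assms by (simp add: Ric3_def R3_def[abs_def] tangent_trace_diff tangent_trace_add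
        tangent_trace_scaleR tangent_trace_rank_one tangent_trace_A D_eq app_at square form_neg)
qed

text \<open>Tracing over the third argument exchanges the roles: the \<open>D2\<close> term becomes
  the traceless multiple of \<open>A\<close>, and the \<open>D3\<close> term is of rank one,
  evaluating \<open>D3\<close> at \<open>AX\<close>.\<close>

lemma trR3_eq:
  assumes "Y differentiable (at x)"
  shows "trR3 \<Gamma> A \<pi> X Y x =
    tangent_trace (\<lambda>Z. curvature \<Gamma> X Y Z) x + P (Y x) (A x (X x)) - \<pi> x (X x) * \<pi> x (Y x)"
proof -
  have "linear (\<lambda>u. D3 \<Gamma> A \<pi> Y (\<lambda>_. u) x)"
    using linear_rules unfolding linear_iff by (simp add: D_eq algebra_simps)
  then show ?thesis
    using assms by (simp add: trR3_def R3_def[abs_def] tangent_trace_diff tangent_trace_add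
        tangent_trace_scaleR tangent_trace_rank_one tangent_trace_A D_eq app_at square form_neg)
qed

text \<open>In \<open>D2(X, Y) - D3(Y, X)\<close> the two quadratic parts are both
  \<open>\<pi>(Y) \<pi>(AX)\<close> and cancel.\<close>

lemma R5_eq:
  assumes "X differentiable (at x)" "Y differentiable (at x)" "Z differentiable (at x)"
  shows "R5 \<Gamma> A \<pi> X Y Z x = curvature \<Gamma> X Y Z x
     - ((P (X x) (Y x) - P (Y x) (X x)) / 2) *\<^sub>R A x (Z x)
     - ((P (X x) (Z x) + \<pi> x (X x) * \<pi> x (A x (Z x))) / 2) *\<^sub>R A x (Y x)
     + ((P (Y x) (Z x) + \<pi> x (Z x) * \<pi> x (A x (Y x))) / 2) *\<^sub>R A x (X x)
     - (\<pi> x (Y x) * \<pi> x (X x) / 2) *\<^sub>R Z x + (\<pi> x (Y x) * \<pi> x (Z x) / 2) *\<^sub>R X x"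
  using assms by (simp add: R5_def D_eq app_at algebra_simps add_divide_distrib diff_divide_distrib)

lemma Ric5_eq:
  assumes "Y differentiable (at x)" "Z differentiable (at x)"
  shows "Ric5 \<Gamma> A \<pi> Y Z x = tangent_trace (\<lambda>X. curvature \<Gamma> X Y Z) x
    + (P (Y x) (A x (Z x)) - P (A x (Z x)) (Y x) - P (A x (Y x)) (Z x)
       - \<pi> x (A x (Y x)) * \<pi> x (A x (Z x))
       + (real CARD('n) - 1) * (\<pi> x (Y x) * \<pi> x (Z x))) / 2"
proof -
  \<comment> \<open>\<open>R5_eq\<close> is available only at \<open>x\<close>, but the trace
    evaluates its argument only there, so any field with the right value at \<open>x\<close> may
    stand in. The term \<open>app A X y\<close> keeps the form in which
    \<open>tangent_trace_A\<close> applies.\<close>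
  have "Ric5 \<Gamma> A \<pi> Y Z x = tangent_trace (\<lambda>X y. curvature \<Gamma> X Y Z y
     - ((P (X y) (Y y) - P (Y y) (X y)) / 2) *\<^sub>R A y (Z y)
     - ((P (X y) (Z y) + \<pi> y (X y) * \<pi> y (A y (Z y))) / 2) *\<^sub>R A y (Y y)
     + ((P (Y y) (Z y) + \<pi> y (Z y) * \<pi> y (A y (Y y))) / 2) *\<^sub>R app A X y
     - (\<pi> y (Y y) * \<pi> y (X y) / 2) *\<^sub>R Z y + (\<pi> y (Y y) * \<pi> y (Z y) / 2) *\<^sub>R X y) x"
    using assms by (simp add: Ric5_def tangent_trace_def R5_eq app_at)
  also have "\<dots> = tangent_trace (\<lambda>X. curvature \<Gamma> X Y Z) x
     - (P (A x (Z x)) (Y x) - P (Y x) (A x (Z x))) / 2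
     - (P (A x (Y x)) (Z x) + \<pi> x (A x (Y x)) * \<pi> x (A x (Z x))) / 2
     - \<pi> x (Y x) * \<pi> x (Z x) / 2 + \<pi> x (Y x) * \<pi> x (Z x) / 2 * real CARD('n)"
  proof -
    have l: "linear (\<lambda>u. (P u (Y x) - P (Y x) u) / 2)"
      "linear (\<lambda>u. (P u (Z x) + \<pi> x u * \<pi> x (A x (Z x))) / 2)"
      "linear (\<lambda>u. \<pi> x (Y x) * \<pi> x u / 2)"
      using linear_rules unfolding linear_iff by (simp_all add: field_simps)
    show ?thesis
      unfolding tangent_trace_add tangent_trace_diff tangent_trace_scaleR tangent_trace_A
        tangent_trace_id
      using l by (simp add: tangent_trace_rank_one)
  qed
  finally show ?thesis by (simp add: field_simps)
qed

text \<open>In the coefficient of \<open>Z\<close>, the \<open>n - 1\<close> part of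
  \<open>Ric5\<close> cancels the quadratic term of \<open>R5\<close>, \<open>Ric1\<close> removes
  \<open>P(X, AY) - P(AY, X)\<close>, and \<open>trR3\<close> removes the rest; the coefficient of
  \<open>X\<close> is analogous. Those of \<open>AX\<close>, \<open>AY\<close>, \<open>AZ\<close>
  cancel against \<open>Ric3\<close>, \<open>trR3\<close> and \<open>Ric1\<close>
  respectively.\<close>

lemma H5_eq:
  assumes d: "X differentiable (at x)" "Y differentiable (at x)" "Z differentiable (at x)"
  shows "H5 \<Gamma> A \<pi> X Y Z x = curvature \<Gamma> X Y Z x
    + (1 / (2 * (real CARD('n) - 1))) *\<^sub>R
        ((tangent_trace (\<lambda>W. curvature \<Gamma> W X Y) x
           - tangent_trace (\<lambda>W. curvature \<Gamma> (app A Y) (app A X) W) x) *\<^sub>R Z x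
       - (tangent_trace (\<lambda>W. curvature \<Gamma> W Y Z) x
           - tangent_trace (\<lambda>W. curvature \<Gamma> (app A Z) (app A Y) W) x) *\<^sub>R X x)
    + (1/2) *\<^sub>R (tangent_trace (\<lambda>W. curvature \<Gamma> W Y (app A X)) x *\<^sub>R A x (Z x)
       - tangent_trace (\<lambda>W. curvature \<Gamma> W Z (app A Y)) x *\<^sub>R A x (X x)
       - tangent_trace (\<lambda>W. curvature \<Gamma> (app A Z) X W) x *\<^sub>R A x (Y x))"
proof -
  \<comment> \<open>Made an atom so that the factor \<open>n - 1\<close> in \<open>Ric5\<close>
    cancels against the denominators of \<open>H5\<close>.\<close>
  define m where "m = real CARD('n) - 1"
  have m: "m \<noteq> 0" using dim by (simp add: m_def)
  show ?thesis
    unfolding H5_def R5_eq[OF d] Ric5_eq[OF d(1,2)] Ric5_eq[OF d(2,3)] Ric1_eq[OF d(1)]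
      Ric1_eq[OF d(2)] Ric3_eq[OF d(3) differentiable_app_A[OF d(2)]] trR3_eq[OF d(1)]
      trR3_eq[OF differentiable_app_A[OF d(1)]] trR3_eq[OF differentiable_app_A[OF d(2)]]
      app_at square P_neg form_neg m_def[symmetric]
    using m by (simp add: vec_eq_iff field_simps)
qed

end

section \<open>Passage from the manifold to a point of a chart\<close>

lemma (in kaehler_manifold) pointwise_complex_structure:
  assumes \<pi>: "one_form atlas \<pi>" and c: "c \<in> atlas" and x: "x \<in> coords c"
  shows "pointwise_complex_structure (coords c) x (\<Gamma> c) (A c) (\<pi> c)"
proof (rule pointwise_complex_structure.intro)
  show "open (coords c)" by (rule chart_image[OF c])
  show "bilinear (\<Gamma> c x)"
    using levi_civita c x by (auto simp: levi_civita_def affine_connection_def)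
  show lin: "linear (A c y)" if "y \<in> coords c" for y
    using endomorphism c that by (auto simp: endomorphism_field_def)
  show "(\<lambda>y. A c y v) differentiable (at x)" for v
    using endomorphism c x by (auto simp: endomorphism_field_def intro: smooth_on_imp_differentiable)
  show "linear (\<pi> c y)" if "y \<in> coords c" for y
    using \<pi> c that by (auto simp: one_form_def)
  show "(\<lambda>y. \<pi> c y v) differentiable (at x)" for v
    using \<pi> c x by (auto simp: one_form_def intro: smooth_on_imp_differentiable)
  show "trace (matrix (A c x)) = 0"
    using metric c x
    by (intro trace_hermitian_complex_structure[where b = "g c x"] lin square hermitian)
      (auto simp: riemannian_metric_def)
qed (use square c x dimension in auto)

theorem theorem4p9:
  fixes M :: "'a topology" and atlas :: "('a, 'n::finite) chart set"
    and g :: "('a, 'n) chart \<Rightarrow> real^'n \<Rightarrow> real^'n \<Rightarrow> real^'n \<Rightarrow> real"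
    and A :: "('a, 'n) chart \<Rightarrow> real^'n \<Rightarrow> real^'n \<Rightarrow> real^'n"
    and \<Gamma> :: "('a, 'n) chart \<Rightarrow> real^'n \<Rightarrow> real^'n \<Rightarrow> real^'n \<Rightarrow> real^'n"
    and \<pi> \<pi>' :: "('a, 'n) chart \<Rightarrow> real^'n \<Rightarrow> real^'n \<Rightarrow> real"
    and N N' :: "('a, 'n) chart \<Rightarrow> 'n vfield \<Rightarrow> 'n vfield \<Rightarrow> 'n vfield"
  assumes "kaehler_manifold M atlas g A \<Gamma>"
    and "one_form atlas \<pi>" and "quarter_symmetric_connection atlas A \<Gamma> \<pi> N"
    and "one_form atlas \<pi>'" and "quarter_symmetric_connection atlas A \<Gamma> \<pi>' N'"
  shows "\<forall>c\<in>atlas. \<forall>X Y Z.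
    smooth_on (coords c) X \<and> smooth_on (coords c) Y \<and> smooth_on (coords c) Z \<longrightarrow>
    (\<forall>x\<in>coords c. H5 (\<Gamma> c) (A c) (\<pi> c) X Y Z x = H5 (\<Gamma> c) (A c) (\<pi>' c) X Y Z x)"
proof (intro ballI allI impI)
  fix c x and X Y Z :: "'n vfield"
  assume c: "c \<in> atlas" and x: "x \<in> coords c"
    and "smooth_on (coords c) X \<and> smooth_on (coords c) Y \<and> smooth_on (coords c) Z"
  then have d: "X differentiable (at x)" "Y differentiable (at x)" "Z differentiable (at x)"
    by (auto intro: smooth_on_imp_differentiable)
  have K: "pointwise_complex_structure (coords c) x (\<Gamma> c) (A c) (\<pi> c)"
    "pointwise_complex_structure (coords c) x (\<Gamma> c) (A c) (\<pi>' c)"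
    by (rule kaehler_manifold.pointwise_complex_structure[OF assms(1) _ c x], fact)+
  show "H5 (\<Gamma> c) (A c) (\<pi> c) X Y Z x = H5 (\<Gamma> c) (A c) (\<pi>' c) X Y Z x"
    \<comment> \<open>The generator has disappeared from the right-hand side of
      \<open>H5_eq\<close>, so both tensors unfold to the same expression.\<close>
    unfolding K[THEN pointwise_complex_structure.H5_eq, OF d] ..
qed

end
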